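(* Let $\omega=1/16$, let $P^0$ satisfy the smallness hypotheses (H) stated in the context, let $P^{k+1}=S_{\mathrm H}(P^k)$ for $k\ge0$, and let $X,Y,Z$ be the limits of the coordinates $x^k,y^k,z^k$. Suppose that the data satisfy the local non-cancellation condition at some $t_0\in\mathbb{R}$, namely $f(t_0)\ne0$ and $$\liminf_{k\to\infty}\frac1k\Bigl|\sum_{j=1}^k\epsilon_j\,\alpha^{\,j}_{i_{j-1}}\Bigr|>0,$$ where $f=\tfrac14(XY'-YX')$, $i_k=\lfloor t_02^k\rfloor$, $\epsilon_j=+1$ if $i_j$ is even and $\epsilon_j=-1$ if $i_j$ is odd, and $\alpha_i^{j}=\tfrac12(e_{2i}^{j}-e_{2i+1}^{j})$ with $e_i^j=2^j(z_{i+1}^j-z_i^j)$. Then the scaled central first differences grow linearly, $$\sup_i\,2^k|z_{i+1}^k-z_i^k|=\Theta(k)\qquad(k\to\infty),$$ and consequently $Z\notin C^1$.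
   Context: For a real sequence $u=\{u_i\}_{i\in\mathbb{Z}}$ the four-point operator $L_4$ with parameter $\omega$ is $(L_4u)_{2i}=u_i$, $(L_4u)_{2i+1}=-\omega u_{i-1}+(\tfrac12+\omega)u_i+(\tfrac12+\omega)u_{i+1}-\omega u_{i+2}$. The Heisenberg four-point subdivision operator $S_{\mathrm H}$ maps $P^k=\{(x_i^k,y_i^k,z_i^k)\}_{i\in\mathbb{Z}}\subset\mathbb{R}^3$ to $P^{k+1}$ defined by $P^{k+1}_{2i}=P^k_i$ and $P^{k+1}_{2i+1}=(X_{2i+1},Y_{2i+1},Z_{2i+1})$ with $X_{2i+1}=(L_4x^k)_{2i+1}$, $Y_{2i+1}=(L_4y^k)_{2i+1}$, $Z_{2i+1}=(L_4z^k)_{2i+1}+R_i^k$, where $R_i^k=\tfrac12(x_i^kb_i^k-y_i^ka_i^k)$, $a_i^k=X_{2i+1}-x_i^k$, $b_i^k=Y_{2i+1}-y_i^k$. Notation: $\|\Delta_hP\|_\infty=\sup_i(|x_{i+1}-x_i|+|y_{i+1}-y_i|)$ and $\|\Delta_h^2P\|_\infty=\sup_i(|x_{i+1}-2x_i+x_{i-1}|+|y_{i+1}-2y_i+y_{i-1}|)$. Hypotheses (H): $\sup_i\|P_i^0\|\le C$, $\|\Delta_hP^0\|_\infty\le\varepsilon_0$, $\|\Delta_h^2P^0\|_\infty\le\varepsilon_0$, for a fixed constant $C$ and a sufficiently small $\varepsilon_0>0$ depending only on $\omega=1/16$ (that is, there exists such an $\varepsilon_0$ for which the result holds). $X,Y,Z:\mathbb{R}\to\mathbb{R}$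 are the uniform-on-compacts limits of the piecewise-linear interpolants taking the values $x_i^k,y_i^k,z_i^k$, respectively, at the dyadic nodes $i2^{-k}$; $X$ and $Y$ are $C^1$ and $Z$ is continuous. *)

theory Defs
  imports "HOL-Analysis.Analysis" "HOL-Library.Landau_Symbols"
begin

text \<open>Index \<open>n = 2 i\<close> or \<open>n = 2 i + 1\<close>, where \<open>i = n div 2\<close> (floor division, also for negative \<open>n\<close>).\<close>

definition four_point :: "real \<Rightarrow> (int \<Rightarrow> real) \<Rightarrow> int \<Rightarrow> real" where
  "four_point w u n = (let i = n div 2 in
     if even n then u i
     else - w * u (i - 1) + (1/2 + w) * u i + (1/2 + w) * u (i + 1) - w * u (i + 2))"

type_synonym polygon = "int \<Rightarrow> real \<times> real \<times> real"

definition xs :: "polygon \<Rightarrow> int \<Rightarrow> real" where "xs P i = fst (P i)"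
definition ys :: "polygon \<Rightarrow> int \<Rightarrow> real" where "ys P i = fst (snd (P i))"
definition zs :: "polygon \<Rightarrow> int \<Rightarrow> real" where "zs P i = snd (snd (P i))"

definition heis_correction :: "real \<Rightarrow> polygon \<Rightarrow> int \<Rightarrow> real" where
  "heis_correction w P i =
     (let a = four_point w (xs P) (2 * i + 1) - xs P i;
          b = four_point w (ys P) (2 * i + 1) - ys P i
      in 1/2 * (xs P i * b - ys P i * a))"

definition heis_subdiv :: "real \<Rightarrow> polygon \<Rightarrow> polygon" where
  "heis_subdiv w P n =
     (if even n then P (n div 2)
      else (four_point w (xs P) n,
            four_point w (ys P) n,
            four_point w (zs P) n + heis_correction w P (n div 2)))"

definition heis_iter :: "real \<Rightarrow> polygon \<Rightarrow> nat \<Rightarrow> polygon" where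
  "heis_iter w P0 k = (heis_subdiv w ^^ k) P0"

text \<open>Suprema over the integers are taken in the extended reals, so that they are meaningful
  without a prior boundedness assumption.\<close>

definition hdiff_norm :: "polygon \<Rightarrow> ereal" where
  "hdiff_norm P =
     (SUP i. ereal (\<bar>xs P (i + 1) - xs P i\<bar> + \<bar>ys P (i + 1) - ys P i\<bar>))"

definition hdiff2_norm :: "polygon \<Rightarrow> ereal" where
  "hdiff2_norm P =
     (SUP i. ereal (\<bar>xs P (i + 1) - 2 * xs P i + xs P (i - 1)\<bar>
                  + \<bar>ys P (i + 1) - 2 * ys P i + ys P (i - 1)\<bar>))"

definition small_data :: "real \<Rightarrow> real \<Rightarrow> polygon \<Rightarrow> bool" where
  "small_data C eps P \<longleftrightarrow>
     (SUP i. ereal (norm (P i))) \<le> ereal C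
     \<and> hdiff_norm P \<le> ereal eps
     \<and> hdiff2_norm P \<le> ereal eps"

text \<open>The piecewise linear function with value \<open>u i\<close> at the node \<open>i / 2 ^ k\<close>.\<close>

definition pl_interp :: "nat \<Rightarrow> (int \<Rightarrow> real) \<Rightarrow> real \<Rightarrow> real" where
  "pl_interp k u t =
     (let s = t * 2 ^ k; i = \<lfloor>s\<rfloor> in u i + (s - of_int i) * (u (i + 1) - u i))"

definition is_limit_function :: "(nat \<Rightarrow> int \<Rightarrow> real) \<Rightarrow> (real \<Rightarrow> real) \<Rightarrow> bool" where
  "is_limit_function u F \<longleftrightarrow>
     (\<forall>K. compact K \<longrightarrow> uniform_limit K (\<lambda>k. pl_interp k (u k)) F sequentially)"

definition scaled_diff :: "(nat \<Rightarrow> int \<Rightarrow> real) \<Rightarrow> nat \<Rightarrow> int \<Rightarrow> real" where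
  "scaled_diff z j i = 2 ^ j * (z j (i + 1) - z j i)"

definition half_jump :: "(nat \<Rightarrow> int \<Rightarrow> real) \<Rightarrow> nat \<Rightarrow> int \<Rightarrow> real" where
  "half_jump z j i = 1/2 * (scaled_diff z j (2 * i) - scaled_diff z j (2 * i + 1))"

definition dyadic_index :: "real \<Rightarrow> nat \<Rightarrow> int" where
  "dyadic_index t k = \<lfloor>t * 2 ^ k\<rfloor>"

definition parity_sign :: "real \<Rightarrow> nat \<Rightarrow> real" where
  "parity_sign t j = (if even (dyadic_index t j) then 1 else -1)"

definition area_density :: "(real \<Rightarrow> real) \<Rightarrow> (real \<Rightarrow> real) \<Rightarrow> real \<Rightarrow> real" where
  "area_density X Y t = 1/4 * (X t * deriv Y t - Y t * deriv X t)"

definition non_cancellation ::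
  "(nat \<Rightarrow> int \<Rightarrow> real) \<Rightarrow> (real \<Rightarrow> real) \<Rightarrow> (real \<Rightarrow> real) \<Rightarrow> real \<Rightarrow> bool" where
  "non_cancellation z X Y t \<longleftrightarrow>
     area_density X Y t \<noteq> 0
     \<and> liminf (\<lambda>k. ereal (1 / real k *
          \<bar>\<Sum>j = 1..k. parity_sign t j * half_jump z j (dyadic_index t (j - 1))\<bar>)) > 0"

definition sup_scaled_diff :: "(nat \<Rightarrow> int \<Rightarrow> real) \<Rightarrow> nat \<Rightarrow> ereal" where
  "sup_scaled_diff z k = (SUP i. ereal (2 ^ k * \<bar>z k (i + 1) - z k i\<bar>))"

end

theory Submission imports Defs begin

text \<open>
  Write \<open>e k i = 2 ^ k * (z k (i + 1) - z k i)\<close> for the scaled differences. Since the scheme keeps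
  the old points, the two differences over the halves of an old interval have the old difference as
  their mean, so they are \<open>e k i + \<alpha>\<close> and \<open>e k i - \<alpha>\<close>, where \<open>\<alpha>\<close> is the half jump between them.
  Descending along the dyadic intervals containing \<open>t\<close>, the sign is read off from the parity of the
  new index, and so the difference next to \<open>t\<close> at level \<open>k\<close> is \<^emph>\<open>exactly\<close> a constant plus
  \<open>\<Sum>j = 1..k. \<epsilon>\<^sub>j \<alpha>\<^sub>j\<close> (\<open>scaled_diff_at_dyadic_index\<close>). Non-cancellation says that this sum
  grows at least linearly, which is the lower bound. It also excludes a \<open>C\<^sup>1\<close> limit, because the
  nodal values of the scheme are values of the limit, and the mean value theorem would bound the same
  differences by the maximum of the derivative near \<open>t\<close>.

  For the upper bound, every half jump must be bounded uniformly in level and position. The kinks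
  \<open>d k i = e k i - e k (i - 1)\<close> obey a linear recursion: a new even kink is
  \<open>3/4 d\<^sub>i - 1/8 (d\<^sub>i\<^sub>-\<^sub>1 + d\<^sub>i\<^sub>+\<^sub>1)\<close> and a new odd one is \<open>1/4 (d\<^sub>i + d\<^sub>i\<^sub>+\<^sub>1)\<close>, plus forcing. The even rule
  has norm 1, so one step does not contract the supremum; but odd kinks are halved, and among
  \<open>i - 1, i, i + 1\<close> the parities alternate. Hence the bound \<open>B\<close> at even and \<open>B / 2\<close> at odd indices is
  multiplied by \<open>7/8\<close> in each step (\<open>kink_bound_Suc\<close>). The horizontal coordinates are unforced, so
  their kinks decay geometrically, their half jumps are summable, and both their values and their
  scaled differences stay bounded. Therefore the Heisenberg correction is \<open>O(2 ^ - k)\<close>, which is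
  exactly the size that acts as a bounded forcing on the kinks of the vertical coordinate. These kinks
  and half jumps then stay bounded, and one bounded half jump is added per level.
\<close>

section \<open>Interpolatory schemes and the binary address of a point\<close>

lemma dyadic_index_Suc:
  "dyadic_index t (Suc k) =
     (if even (dyadic_index t (Suc k)) then 2 * dyadic_index t k else 2 * dyadic_index t k + 1)"
proof -
  have "dyadic_index t (Suc k) div 2 = dyadic_index t k"
    using floor_divide_real_eq_div[of 2 "t * 2 ^ Suc k"] by (simp add: dyadic_index_def)
  then show ?thesis by presburger
qed

locale interpolatory =
  fixes v :: "nat \<Rightarrow> int \<Rightarrow> real"
  assumes interp: "v (Suc k) (2 * i) = v k i"
begin

lemma scaled_diff_even:
  "scaled_diff v (Suc k) (2 * i) = scaled_diff v k i + half_jump v (Suc k) i"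
  using interp[of k i] interp[of k "i + 1"]
  by (simp add: scaled_diff_def half_jump_def algebra_simps)

lemma scaled_diff_odd:
  "scaled_diff v (Suc k) (2 * i + 1) = scaled_diff v k i - half_jump v (Suc k) i"
  using interp[of k i] interp[of k "i + 1"]
  by (simp add: scaled_diff_def half_jump_def algebra_simps)

lemma scaled_diff_increment_le:
  assumes "\<bar>half_jump v (Suc k) (i div 2)\<bar> \<le> M"
  shows "\<bar>scaled_diff v (Suc k) i\<bar> \<le> \<bar>scaled_diff v k (i div 2)\<bar> + M"
proof (cases "even i")
  case True
  then have "i = 2 * (i div 2)" by simp
  then show ?thesis using scaled_diff_even[of k "i div 2"] assms by (smt (verit))
next
  case False
  then have "i = 2 * (i div 2) + 1" by presburger
  then show ?thesis using scaled_diff_odd[of k "i div 2"] assms by (smt (verit))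
qed

text \<open>The half jumps along the binary address of \<open>t\<close> telescope without error: going to the left half
  adds the half jump, going to the right half subtracts it.\<close>

lemma scaled_diff_at_dyadic_index:
  "scaled_diff v k (dyadic_index t k) = scaled_diff v 0 (dyadic_index t 0)
     + (\<Sum>j = 1..k. parity_sign t j * half_jump v j (dyadic_index t (j - 1)))"
proof (induction k)
  case 0
  then show ?case by simp
next
  case (Suc k)
  have "scaled_diff v (Suc k) (dyadic_index t (Suc k)) = scaled_diff v k (dyadic_index t k)
     + parity_sign t (Suc k) * half_jump v (Suc k) (dyadic_index t k)"
  proof (cases "even (dyadic_index t (Suc k))")
    case True
    then have "dyadic_index t (Suc k) = 2 * dyadic_index t k"
      using dyadic_index_Suc[of t k] by simp
    then show ?thesis using True scaled_diff_even[of k "dyadic_index t k"]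
      by (simp add: parity_sign_def)
  next
    case False
    then have "dyadic_index t (Suc k) = 2 * dyadic_index t k + 1"
      using dyadic_index_Suc[of t k] by simp
    then show ?thesis using False scaled_diff_odd[of k "dyadic_index t k"]
      by (simp add: parity_sign_def)
  qed
  then show ?case using Suc.IH by simp
qed

lemma scaled_diff_linear_lower_bound:
  assumes "liminf (\<lambda>k. ereal (1 / real k *
          \<bar>\<Sum>j = 1..k. parity_sign t j * half_jump v j (dyadic_index t (j - 1))\<bar>)) > 0"
  obtains c where "c > 0" "\<forall>\<^sub>F k in sequentially. c * real k \<le> \<bar>scaled_diff v k (dyadic_index t k)\<bar>"
proof -
  define s where "s k = \<bar>\<Sum>j = 1..k. parity_sign t j * half_jump v j (dyadic_index t (j - 1))\<bar>" for k
  obtain c where c: "0 < ereal c" "ereal c < liminf (\<lambda>k. ereal (1 / real k * s k))"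
    using ereal_dense2[of 0] assms unfolding s_def by blast
  define e0 where "e0 = \<bar>scaled_diff v 0 (dyadic_index t 0)\<bar>"
  have ev: "\<forall>\<^sub>F k in sequentially. c < 1 / real k * s k"
    using less_LiminfD[OF c(2)] by simp
  \<comment> \<open>Half of the growth absorbs the initial difference \<open>e0\<close>.\<close>
  have "\<forall>\<^sub>F k in sequentially. c / 2 * real k \<le> \<bar>scaled_diff v k (dyadic_index t k)\<bar>"
    using ev eventually_gt_at_top[of 0] eventually_ge_at_top[of "nat \<lceil>2 * e0 / c\<rceil>"]
  proof eventually_elim
    case (elim k)
    have "c * real k < s k" using elim by (simp add: field_simps)
    moreover have "2 * e0 / c \<le> real k" using elim by linarith
    then have "e0 \<le> c / 2 * real k" using c(1) by (simp add: field_simps)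
    moreover have "s k - e0 \<le> \<bar>scaled_diff v k (dyadic_index t k)\<bar>"
      unfolding scaled_diff_at_dyadic_index[of k t] s_def e0_def by linarith
    ultimately show ?case by (simp add: field_simps)
  qed
  then show thesis using that[of "c / 2"] c(1) by simp
qed

lemma value_at_finer_level: "v (k + m) (i * 2 ^ m) = v k i"
proof (induction m)
  case (Suc m)
  then show ?case using interp[of "k + m" "i * 2 ^ m"] by (simp add: ac_simps)
qed simp

text \<open>From level \<open>k\<close> on, all interpolants agree at a node of level \<open>k\<close>.\<close>

lemma limit_at_dyadic_node:
  assumes "is_limit_function v F"
  shows "F (of_int i / 2 ^ k) = v k i"
proof -
  let ?t = "of_int i / 2 ^ k :: real"
  have "uniform_limit {?t} (\<lambda>k. pl_interp k (v k)) F sequentially"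
    using assms unfolding is_limit_function_def by (blast intro: compact_sing)
  then have lim: "(\<lambda>n. pl_interp n (v n) ?t) \<longlonglongrightarrow> F ?t"
    by (rule tendsto_uniform_limitI) simp
  have "pl_interp (m + k) (v (m + k)) ?t = v k i" for m
  proof -
    have "?t * 2 ^ (m + k) = of_int (i * 2 ^ m)" by (simp add: power_add)
    then show ?thesis
      unfolding pl_interp_def Let_def using value_at_finer_level[of k m i]
      by (simp only: floor_of_int) (simp add: add.commute)
  qed
  then have "(\<lambda>m. pl_interp (m + k) (v (m + k)) ?t) \<longlonglongrightarrow> v k i" by simp
  then have "(\<lambda>n. pl_interp n (v n) ?t) \<longlonglongrightarrow> v k i"
    by (rule LIMSEQ_offset)
  then show ?thesis using lim LIMSEQ_unique by blast
qed

text \<open>Each scaled difference is a difference quotient of the limit over an interval of length at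
  most 1 around \<open>t\<close>.\<close>

lemma scaled_diff_bounded_if_C1:
  assumes lim: "is_limit_function v F" and C1: "F C1_differentiable_on UNIV"
  obtains M where "\<And>k. \<bar>scaled_diff v k (dyadic_index t k)\<bar> \<le> M"
proof -
  obtain D where D: "\<And>x. (F has_vector_derivative D x) (at x)" "continuous_on UNIV D"
    using C1 unfolding C1_differentiable_on_def by auto
  have "compact (D ` {t - 1..t + 1})"
    using D(2) by (intro compact_continuous_image continuous_on_subset[OF D(2)]) auto
  then obtain M where M: "\<And>x. x \<in> {t - 1..t + 1} \<Longrightarrow> \<bar>D x\<bar> \<le> M"
    using compact_imp_bounded bounded_iff by (metis imageI real_norm_def)
  have "\<bar>scaled_diff v k (dyadic_index t k)\<bar> \<le> M" for k
  proof -
    define i where "i = dyadic_index t k"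
    define a b :: real where "a = of_int i / 2 ^ k" and "b = of_int (i + 1) / 2 ^ k"
    have ab: "a < b" "b - a = 1 / 2 ^ k" by (simp_all add: a_def b_def field_simps)
    have i: "of_int i \<le> t * 2 ^ k" "t * 2 ^ k < of_int i + 1"
      unfolding i_def dyadic_index_def by linarith+
    have "a \<le> t" "t \<le> b" using i by (simp_all add: a_def b_def field_simps)
    moreover have "b - a \<le> 1" by (simp add: ab)
    ultimately have sub: "{a..b} \<subseteq> {t - 1..t + 1}" by auto
    have "\<And>x. DERIV F x :> D x"
      using D(1) by (simp add: has_real_derivative_iff_has_vector_derivative)
    then obtain z where z: "a < z" "z < b" "F b - F a = (b - a) * D z"
      using MVT2[OF ab(1), of F D] by blast
    have "scaled_diff v k i = 2 ^ k * (F b - F a)"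
      unfolding a_def b_def limit_at_dyadic_node[OF lim] by (simp add: scaled_diff_def)
    also have "\<dots> = D z" unfolding z(3) ab(2) by simp
    finally show ?thesis using M[of z] sub z unfolding i_def by auto
  qed
  then show thesis using that by blast
qed

end

section \<open>Kinks of a forced four-point scheme\<close>

definition kink :: "(nat \<Rightarrow> int \<Rightarrow> real) \<Rightarrow> nat \<Rightarrow> int \<Rightarrow> real" where
  "kink v k i = scaled_diff v k i - scaled_diff v k (i - 1)"

text \<open>The weight \<open>1/2\<close> at odd indices turns the recursion of the kinks into a one-step contraction;
  the plain supremum is contracted only over two steps.\<close>

definition kink_bound :: "(nat \<Rightarrow> int \<Rightarrow> real) \<Rightarrow> nat \<Rightarrow> real \<Rightarrow> bool" where
  "kink_bound v k B \<longleftrightarrow> (\<forall>i. \<bar>kink v k i\<bar> \<le> (if even i then B else B / 2))"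

locale forced_four_point = interpolatory v for v +
  fixes r :: "nat \<Rightarrow> int \<Rightarrow> real"
  assumes insert: "v (Suc k) (2 * i + 1) = four_point (1/16) (v k) (2 * i + 1) + r k i"
begin

text \<open>The mask deviates from the midpoint rule by \<open>1/16\<close> of a sum of two second differences, and the
  forcing moves the inserted point relative to both of its neighbours.\<close>

lemma half_jump_eq:
  "half_jump v (Suc k) i = - 1/8 * (kink v k i + kink v k (i + 1)) + 2 ^ Suc k * r k i"
proof -
  have "half_jump v (Suc k) i = 2 ^ k * (2 * v (Suc k) (2 * i + 1) - v k i - v k (i + 1))"
    using interp[of k i] interp[of k "i + 1"]
    by (simp add: scaled_diff_def half_jump_def algebra_simps)
  moreover have "2 * v (Suc k) (2 * i + 1) - v k i - v k (i + 1)
      = - 1/8 * (v k (i - 1) - v k i - v k (i + 1) + v k (i + 2)) + 2 * r k i"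
    unfolding insert by (simp add: four_point_def field_simps)
  moreover have "kink v k i + kink v k (i + 1)
      = 2 ^ k * (v k (i - 1) - v k i - v k (i + 1) + v k (i + 2))"
    by (simp add: scaled_diff_def kink_def algebra_simps)
  ultimately show ?thesis by (simp only: power_Suc distrib_left mult_ac)
qed

lemma kink_odd: "kink v (Suc k) (2 * i + 1) = - 2 * half_jump v (Suc k) i"
  unfolding kink_def using scaled_diff_even[of k i] scaled_diff_odd[of k i] by simp

lemma kink_even:
  "kink v (Suc k) (2 * i) = kink v k i + half_jump v (Suc k) i + half_jump v (Suc k) (i - 1)"
  using scaled_diff_even[of k i] scaled_diff_odd[of k "i - 1"]
  by (simp add: kink_def algebra_simps)

text \<open>Exactly one of \<open>i\<close> and \<open>i + 1\<close> is odd, so the two kinks contribute \<open>B + B / 2\<close>.\<close>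

lemma half_jump_le:
  assumes "kink_bound v k B" and "\<bar>2 ^ Suc k * r k i\<bar> \<le> \<rho>"
  shows "\<bar>half_jump v (Suc k) i\<bar> \<le> 3/16 * B + \<rho>"
proof -
  have "\<bar>kink v k i\<bar> \<le> (if even i then B else B / 2)"
    and "\<bar>kink v k (i + 1)\<bar> \<le> (if even i then B / 2 else B)"
    using assms(1) unfolding kink_bound_def by (auto dest: spec[of _ i] spec[of _ "i + 1"])
  then have pair: "\<bar>kink v k i\<bar> + \<bar>kink v k (i + 1)\<bar> \<le> 3/2 * B" by (auto split: if_splits)
  have "\<bar>half_jump v (Suc k) i\<bar>
      \<le> 1/8 * (\<bar>kink v k i\<bar> + \<bar>kink v k (i + 1)\<bar>) + \<bar>2 ^ Suc k * r k i\<bar>"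
    unfolding half_jump_eq
    by (rule order_trans[OF abs_triangle_ineq add_right_mono]) (simp add: abs_mult)
  also have "\<dots> \<le> 1/8 * (3/2 * B) + \<rho>"
    by (intro add_mono mult_left_mono pair assms(2)) simp
  finally show ?thesis by simp
qed

text \<open>At an even \<open>i\<close> the full weight \<open>3/4\<close> meets two halved neighbours, giving \<open>3/4 + 1/8 = 7/8\<close>; at an
  odd \<open>i\<close> the roles are exchanged, giving \<open>3/8 + 1/4\<close>. A new odd kink is twice a half jump, giving
  \<open>3/8\<close>, which is below half of \<open>7/8\<close>. The two assumptions on \<open>B'\<close> are what is needed for the even and
  the odd indices, respectively; \<open>B' = B\<close> is admissible as soon as \<open>B \<ge> 16 \<rho>\<close>.\<close>

lemma kink_bound_Suc:
  assumes B: "kink_bound v k B" and \<rho>: "\<And>i. \<bar>2 ^ Suc k * r k i\<bar> \<le> \<rho>"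
    and B': "7/8 * B + 2 * \<rho> \<le> B'" "3/8 * B + 2 * \<rho> \<le> B' / 2"
  shows "kink_bound v (Suc k) B'"
  unfolding kink_bound_def
proof
  fix n :: int
  define i where "i = n div 2"
  have d: "\<bar>kink v k j\<bar> \<le> (if even j then B else B / 2)" for j
    using B unfolding kink_bound_def by blast
  have "0 \<le> B" using d[of 0] by simp
  show "\<bar>kink v (Suc k) n\<bar> \<le> (if even n then B' else B' / 2)"
  proof (cases "even n")
    case True
    then have n: "n = 2 * i" by (simp add: i_def)
    have eq: "kink v (Suc k) n = 3/4 * kink v k i - 1/8 * (kink v k (i - 1) + kink v k (i + 1))
        + 2 ^ Suc k * r k i + 2 ^ Suc k * r k (i - 1)"
      unfolding n kink_even half_jump_eq by (simp add: field_simps)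
    have "\<bar>3/4 * kink v k i - 1/8 * (kink v k (i - 1) + kink v k (i + 1))\<bar>
        \<le> 3/4 * \<bar>kink v k i\<bar> + 1/8 * \<bar>kink v k (i - 1) + kink v k (i + 1)\<bar>"
      by (rule order_trans[OF abs_triangle_ineq4]) (simp add: abs_mult)
    also have "\<dots> \<le> 3/4 * \<bar>kink v k i\<bar> + 1/8 * (\<bar>kink v k (i - 1)\<bar> + \<bar>kink v k (i + 1)\<bar>)"
      by (intro add_left_mono mult_left_mono abs_triangle_ineq) simp
    also have "\<dots> \<le> 3/4 * (if even i then B else B / 2)
        + 1/8 * ((if even (i - 1) then B else B / 2) + (if even (i + 1) then B else B / 2))"
      by (intro add_mono mult_left_mono d) simp_all
    also have "\<dots> \<le> 7/8 * B" using \<open>0 \<le> B\<close> by simp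
    finally have core: "\<bar>3/4 * kink v k i - 1/8 * (kink v k (i - 1) + kink v k (i + 1))\<bar> \<le> 7/8 * B" .
    have "\<bar>kink v (Suc k) n\<bar> \<le> 7/8 * B + \<rho> + \<rho>"
      unfolding eq by (intro order_trans[OF abs_triangle_ineq] add_mono \<rho> core)
    then show ?thesis using True B'(1) by simp
  next
    case False
    then have n: "n = 2 * i + 1" unfolding i_def by presburger
    show ?thesis using half_jump_le[OF B \<rho>[of i]] kink_odd[of k i] B'(2) False
      unfolding n by simp
  qed
qed

end

text \<open>The kinks are at most \<open>4 * C\<close>; the factor 2 pays for the weight at odd indices.\<close>

lemma initial_bounds:
  assumes "\<And>i. \<bar>v 0 i\<bar> \<le> C"
  shows "\<bar>scaled_diff v 0 i\<bar> \<le> 2 * C" and "kink_bound v 0 (8 * C)"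
proof -
  have e: "\<bar>scaled_diff v 0 i\<bar> \<le> 2 * C" for i
    using assms[of i] assms[of "i + 1"] by (simp add: scaled_diff_def)
  then show "\<bar>scaled_diff v 0 i\<bar> \<le> 2 * C" .
  have "0 \<le> C" using assms[of 0] by linarith
  moreover have "\<bar>kink v 0 i\<bar> \<le> 4 * C" for i
    using e[of i] e[of "i - 1"] unfolding kink_def by linarith
  ultimately show "kink_bound v 0 (8 * C)"
    unfolding kink_bound_def by (smt (verit) field_sum_of_halves)
qed

context forced_four_point
begin

text \<open>The half jumps decay like \<open>(7/8) ^ k\<close>, so they sum to a bounded total.\<close>

lemma unforced_scaled_diff_le:
  assumes C: "\<And>i. \<bar>v 0 i\<bar> \<le> C" and "\<And>k i. r k i = 0"
  shows "\<bar>scaled_diff v k i\<bar> \<le> 14 * C"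
proof -
  have "0 \<le> C" using C[of 0] by linarith
  have kinks: "kink_bound v k (8 * C * (7/8) ^ k)" for k
  proof (induction k)
    case 0
    then show ?case using initial_bounds(2)[of v, OF C] by simp
  next
    case (Suc k)
    then show ?case by (rule kink_bound_Suc[where \<rho> = 0]) (use assms \<open>0 \<le> C\<close> in simp_all)
  qed
  \<comment> \<open>The partial sums of the half jump bounds \<open>3/2 * C * (7/8) ^ k\<close>, starting from \<open>2 * C\<close>.\<close>
  have "\<bar>scaled_diff v k i\<bar> \<le> 2 * C + 12 * C * (1 - (7/8) ^ k)"
  proof (induction k arbitrary: i)
    case 0
    then show ?case using initial_bounds(1)[of v, OF C] by simp
  next
    case (Suc k)
    have "\<bar>scaled_diff v (Suc k) i\<bar> \<le> \<bar>scaled_diff v k (i div 2)\<bar> + (3/16 * (8 * C * (7/8) ^ k) + 0)"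
      by (intro scaled_diff_increment_le half_jump_le kinks) (simp add: assms)
    with Suc[of "i div 2"] show ?case by (simp add: algebra_simps)
  qed
  also have "\<dots> \<le> 14 * C" using \<open>0 \<le> C\<close> by (simp add: algebra_simps)
  finally show ?thesis .
qed

text \<open>An inserted point lies one new difference, of size at most \<open>14 * C / 2 ^ Suc k\<close>, away from an old
  point; these distances are summable.\<close>

lemma unforced_value_le:
  assumes C: "\<And>i. \<bar>v 0 i\<bar> \<le> C" and r: "\<And>k i. r k i = 0"
  shows "\<bar>v k i\<bar> \<le> 15 * C"
proof -
  have "0 \<le> C" using C[of 0] by linarith
  have "\<bar>v k i\<bar> \<le> C + 14 * C * (1 - 1 / 2 ^ k)"
  proof (induction k arbitrary: i)
    case 0
    then show ?case using C by simp
  next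
    case (Suc k)
    define j where "j = i div 2"
    have IH: "\<bar>v k j\<bar> \<le> C + 14 * C * (1 - 1 / 2 ^ k)" by (rule Suc)
    have mono: "C + 14 * C * (1 - 1 / 2 ^ Suc k) = C + 14 * C * (1 - 1 / 2 ^ k) + 14 * C / 2 ^ Suc k"
      by (simp add: field_simps)
    show ?case
    proof (cases "even i")
      case True
      then have "v (Suc k) i = v k j" using interp[of k j] by (simp add: j_def)
      moreover have "0 \<le> 14 * C / 2 ^ Suc k" using \<open>0 \<le> C\<close> by simp
      ultimately show ?thesis using IH mono by linarith
    next
      case False
      then have i: "i = 2 * j + 1" unfolding j_def by presburger
      have "v (Suc k) i = v k j + scaled_diff v (Suc k) (2 * j) / 2 ^ Suc k"
        using interp[of k j] by (simp add: i scaled_diff_def)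
      moreover have "\<bar>scaled_diff v (Suc k) (2 * j) / 2 ^ Suc k\<bar> \<le> 14 * C / 2 ^ Suc k"
        using unforced_scaled_diff_le[OF C r, of "Suc k" "2 * j"]
        by (simp only: abs_divide power_abs abs_numeral) (simp add: field_simps)
      ultimately show ?thesis using IH mono by linarith
    qed
  qed
  also have "\<dots> \<le> 15 * C" using \<open>0 \<le> C\<close> by (simp add: algebra_simps)
  finally show ?thesis .
qed

text \<open>With bounded forcing the kinks no longer decay, but the level \<open>B = max (8 * C) (16 * \<rho>)\<close> is
  preserved: it dominates the initial kinks and absorbs the forcing.\<close>

lemma forced_scaled_diff_le:
  assumes C: "\<And>i. \<bar>v 0 i\<bar> \<le> C" and \<rho>: "\<And>k i. \<bar>2 ^ Suc k * r k i\<bar> \<le> \<rho>"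
  shows "\<bar>scaled_diff v k i\<bar> \<le> 2 * C + (3/16 * max (8 * C) (16 * \<rho>) + \<rho>) * real k"
proof -
  define B where "B = max (8 * C) (16 * \<rho>)"
  have kinks: "kink_bound v k B" for k
  proof (induction k)
    case 0
    have "\<bar>kink v 0 i\<bar> \<le> (if even i then B else B / 2)" for i
      using initial_bounds(2)[of v, OF C] unfolding kink_bound_def B_def
      by (smt (verit) divide_right_mono)
    then show ?case unfolding kink_bound_def by blast
  next
    case (Suc k)
    have "16 * \<rho> \<le> B" unfolding B_def by simp
    with Suc show ?case by (intro kink_bound_Suc[where B = B and \<rho> = \<rho>] \<rho>) simp_all
  qed
  define M where "M = 3/16 * B + \<rho>"
  have "\<bar>scaled_diff v k i\<bar> \<le> 2 * C + M * real k"
  proof (induction k arbitrary: i)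
    case 0
    then show ?case using initial_bounds(1)[of v, OF C] by simp
  next
    case (Suc k)
    have "\<bar>scaled_diff v (Suc k) i\<bar> \<le> \<bar>scaled_diff v k (i div 2)\<bar> + M"
      unfolding M_def by (intro scaled_diff_increment_le half_jump_le kinks \<rho>)
    with Suc[of "i div 2"] show ?case by (simp add: algebra_simps)
  qed
  then show ?thesis unfolding M_def B_def .
qed

end

section \<open>The Heisenberg four-point scheme\<close>

lemma heis_iter_Suc: "heis_iter w P (Suc k) = heis_subdiv w (heis_iter w P k)"
  by (simp add: heis_iter_def)

lemma xs_forced_four_point:
  "forced_four_point (\<lambda>k. xs (heis_iter (1/16) P k)) (\<lambda>k i. 0)"
  by unfold_locales (simp_all add: heis_iter_Suc xs_def heis_subdiv_def)

lemma ys_forced_four_point: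
  "forced_four_point (\<lambda>k. ys (heis_iter (1/16) P k)) (\<lambda>k i. 0)"
  by unfold_locales (simp_all add: heis_iter_Suc ys_def heis_subdiv_def)

lemma zs_forced_four_point:
  "forced_four_point (\<lambda>k. zs (heis_iter (1/16) P k))
     (\<lambda>k. heis_correction (1/16) (heis_iter (1/16) P k))"
  by unfold_locales (simp_all add: heis_iter_Suc zs_def heis_subdiv_def)

lemma coordinates_le_norm:
  fixes P :: polygon
  shows "\<bar>xs P i\<bar> \<le> norm (P i)" "\<bar>ys P i\<bar> \<le> norm (P i)" "\<bar>zs P i\<bar> \<le> norm (P i)"
  using norm_fst_le[of "fst (P i)" "snd (P i)"] norm_snd_le[of "snd (P i)" "fst (P i)"]
    norm_fst_le[of "fst (snd (P i))" "snd (snd (P i))"]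
    norm_snd_le[of "snd (snd (P i))" "fst (snd (P i))"]
  by (simp_all add: xs_def ys_def zs_def)

text \<open>The correction is a symplectic product of a bounded point with a horizontal chord, and the
  chord has length \<open>O(2 ^ - k)\<close>.\<close>

lemma heis_correction_le:
  assumes P: "\<And>i. norm (P i) \<le> C"
  shows "\<bar>2 ^ Suc k * heis_correction (1/16) (heis_iter (1/16) P k) i\<bar> \<le> 210 * C\<^sup>2"
proof -
  define x y where "x k = xs (heis_iter (1/16) P k)" and "y k = ys (heis_iter (1/16) P k)" for k
  interpret X: forced_four_point x "\<lambda>k i. 0" unfolding x_def by (rule xs_forced_four_point)
  interpret Y: forced_four_point y "\<lambda>k i. 0" unfolding y_def by (rule ys_forced_four_point)
  have C: "\<bar>x 0 j\<bar> \<le> C" "\<bar>y 0 j\<bar> \<le> C" for j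
    using P[of j] coordinates_le_norm[of P j] by (simp_all add: x_def y_def heis_iter_def)
  have "0 \<le> C" using C(1)[of 0] by linarith
  have chord: "scaled_diff x (Suc k) (2 * i) = 2 ^ Suc k * (four_point (1/16) (x k) (2 * i + 1) - x k i)"
    "scaled_diff y (Suc k) (2 * i) = 2 ^ Suc k * (four_point (1/16) (y k) (2 * i + 1) - y k i)"
    unfolding scaled_diff_def X.interp Y.interp X.insert Y.insert by simp_all
  have eq: "2 ^ Suc k * heis_correction (1/16) (heis_iter (1/16) P k) i
      = 1/2 * (x k i * scaled_diff y (Suc k) (2 * i) - y k i * scaled_diff x (Suc k) (2 * i))"
    unfolding chord heis_correction_def Let_def x_def[symmetric] y_def[symmetric]
    by (simp only: right_diff_distrib mult_ac)
  have "\<bar>x k i * scaled_diff y (Suc k) (2 * i)\<bar> \<le> (15 * C) * (14 * C)"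
    unfolding abs_mult
    by (intro mult_mono X.unforced_value_le Y.unforced_scaled_diff_le C) (use \<open>0 \<le> C\<close> in simp_all)
  moreover have "\<bar>y k i * scaled_diff x (Suc k) (2 * i)\<bar> \<le> (15 * C) * (14 * C)"
    unfolding abs_mult
    by (intro mult_mono Y.unforced_value_le X.unforced_scaled_diff_le C) (use \<open>0 \<le> C\<close> in simp_all)
  ultimately have "1/2 * (\<bar>x k i * scaled_diff y (Suc k) (2 * i)\<bar>
      + \<bar>y k i * scaled_diff x (Suc k) (2 * i)\<bar>) \<le> 210 * C\<^sup>2"
    by (simp add: power2_eq_square)
  then show ?thesis unfolding eq
    by (rule order_trans[rotated]) (simp only: abs_mult[of "1/2"], simp)
qed

lemma zs_scaled_diff_linear_upper_bound:
  assumes P: "\<And>i. norm (P i) \<le> C"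
  obtains A B where "\<And>k i. \<bar>scaled_diff (\<lambda>k. zs (heis_iter (1/16) P k)) k i\<bar> \<le> A + B * real k"
proof -
  interpret Z: forced_four_point "\<lambda>k. zs (heis_iter (1/16) P k)"
    "\<lambda>k. heis_correction (1/16) (heis_iter (1/16) P k)" by (rule zs_forced_four_point)
  have "\<bar>zs (heis_iter (1/16) P 0) i\<bar> \<le> C" for i
    using P[of i] coordinates_le_norm(3)[of P i] by (simp add: heis_iter_def)
  from that[OF Z.forced_scaled_diff_le[OF this heis_correction_le[OF P]]] show thesis .
qed

lemma sup_scaled_diff_eq: "sup_scaled_diff z k = (SUP i. ereal \<bar>scaled_diff z k i\<bar>)"
  by (simp add: sup_scaled_diff_def scaled_diff_def abs_mult)

lemma sup_scaled_diff_bounds: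
  assumes "\<And>i. \<bar>scaled_diff z k i\<bar> \<le> M"
  shows "sup_scaled_diff z k < \<infinity>"
    and "real_of_ereal (sup_scaled_diff z k) \<le> M"
    and "\<bar>scaled_diff z k i\<bar> \<le> real_of_ereal (sup_scaled_diff z k)"
proof -
  have up: "sup_scaled_diff z k \<le> ereal M"
    unfolding sup_scaled_diff_eq using assms by (intro SUP_least) simp
  have low: "ereal \<bar>scaled_diff z k j\<bar> \<le> sup_scaled_diff z k" for j
    unfolding sup_scaled_diff_eq by (rule SUP_upper) simp
  obtain s where "sup_scaled_diff z k = ereal s"
    using up low[of 0] by (cases "sup_scaled_diff z k") auto
  then show "sup_scaled_diff z k < \<infinity>" "real_of_ereal (sup_scaled_diff z k) \<le> M"
    "\<bar>scaled_diff z k i\<bar> \<le> real_of_ereal (sup_scaled_diff z k)"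
    using up low[of i] by simp_all
qed

theorem theorem5p13:
  "\<exists>eps0 > (0::real). \<forall>(C::real) (P0::polygon) (X::real \<Rightarrow> real) (Y::real \<Rightarrow> real) (Z::real \<Rightarrow> real) (t0::real).
     small_data C eps0 P0
     \<longrightarrow> is_limit_function (\<lambda>k. xs (heis_iter (1/16) P0 k)) X
     \<longrightarrow> is_limit_function (\<lambda>k. ys (heis_iter (1/16) P0 k)) Y
     \<longrightarrow> is_limit_function (\<lambda>k. zs (heis_iter (1/16) P0 k)) Z
     \<longrightarrow> X C1_differentiable_on UNIV \<longrightarrow> Y C1_differentiable_on UNIV \<longrightarrow> continuous_on UNIV Z
     \<longrightarrow> non_cancellation (\<lambda>k. zs (heis_iter (1/16) P0 k)) X Y t0
     \<longrightarrow> (\<forall>k. sup_scaled_diff (\<lambda>k. zs (heis_iter (1/16) P0 k)) k < \<infinity>)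
         \<and> (\<lambda>k. real_of_ereal (sup_scaled_diff (\<lambda>k. zs (heis_iter (1/16) P0 k)) k)) \<in> \<Theta>(\<lambda>k. real k)
         \<and> \<not> Z C1_differentiable_on UNIV"
proof -
  have main: "(\<forall>k. sup_scaled_diff z k < \<infinity>)
         \<and> (\<lambda>k. real_of_ereal (sup_scaled_diff z k)) \<in> \<Theta>(\<lambda>k. real k)
         \<and> \<not> Z C1_differentiable_on UNIV"
    if small: "small_data C 1 P0"
      and z: "z = (\<lambda>k. zs (heis_iter (1/16) P0 k))"
      and lim: "is_limit_function z Z"
      and nc: "non_cancellation z X Y t0"
    for C :: real and P0 :: polygon and X Y Z :: "real \<Rightarrow> real" and t0 :: real and z
  proof -
    interpret forced_four_point z "\<lambda>k. heis_correction (1/16) (heis_iter (1/16) P0 k)"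
      unfolding z by (rule zs_forced_four_point)
    have "norm (P0 i) \<le> C" for i
      using small unfolding small_data_def by (simp add: SUP_le_iff)
    then obtain A B where AB: "\<And>k i. \<bar>scaled_diff z k i\<bar> \<le> A + B * real k"
      using zs_scaled_diff_linear_upper_bound unfolding z by metis
    obtain c where c: "c > 0"
      "\<forall>\<^sub>F k in sequentially. c * real k \<le> \<bar>scaled_diff z k (dyadic_index t0 k)\<bar>"
      using scaled_diff_linear_lower_bound nc unfolding non_cancellation_def by blast
    let ?S = "\<lambda>k. real_of_ereal (sup_scaled_diff z k)"
    have "\<forall>\<^sub>F k in sequentially. norm (?S k) \<le> (\<bar>A\<bar> + \<bar>B\<bar>) * norm (real k)"
      using eventually_ge_at_top[of 1]
    proof eventually_elim
      case (elim k)
      have "\<bar>A\<bar> * 1 \<le> \<bar>A\<bar> * real k" using elim by (intro mult_left_mono) auto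
      moreover have "B * real k \<le> \<bar>B\<bar> * real k" by (intro mult_right_mono) auto
      ultimately have "A + B * real k \<le> (\<bar>A\<bar> + \<bar>B\<bar>) * real k" by (simp add: algebra_simps)
      moreover have "?S k \<le> A + B * real k" "0 \<le> ?S k"
        using sup_scaled_diff_bounds(2,3)[of z k, OF AB] by (simp, metis abs_ge_zero order_trans)
      ultimately show ?case by (simp only: real_norm_def abs_of_nonneg of_nat_0_le_iff)
    qed
    then have up: "?S \<in> O(\<lambda>k. real k)" by (rule bigoI)
    have "\<forall>\<^sub>F k in sequentially. c * norm (real k) \<le> norm (?S k)"
      using c(2)
    proof eventually_elim
      case (elim k)
      then show ?case
        using sup_scaled_diff_bounds(3)[of z k, OF AB, of "dyadic_index t0 k"]
        by (simp only: real_norm_def abs_of_nat)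
    qed
    then have low: "?S \<in> \<Omega>(\<lambda>k. real k)" by (rule landau_omega.bigI[OF c(1)])
    have "\<not> Z C1_differentiable_on UNIV"
    proof
      assume "Z C1_differentiable_on UNIV"
      then obtain M where M: "\<And>k. \<bar>scaled_diff z k (dyadic_index t0 k)\<bar> \<le> M"
        using scaled_diff_bounded_if_C1[OF lim] by blast
      have "\<forall>\<^sub>F k in sequentially. M / c < real k"
        using filterlim_real_sequentially eventually_gt_at_top filterlim_iff by blast
      with c(2) have "\<forall>\<^sub>F k in sequentially. False"
      proof eventually_elim
        case (elim k)
        then show ?case using M[of k] c(1) by (simp add: field_simps)
      qed
      then show False by simp
    qed
    then show ?thesis using up low sup_scaled_diff_bounds(1)[of z, OF AB] by blast
  qed
  \<comment> \<open>The contraction factor \<open>7/8\<close> is the same for all data, so the threshold 1 works.\<close>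
  show ?thesis by (intro exI[of _ 1] conjI allI impI zero_less_one main[OF _ refl])
qed

end
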